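(* Let $G$ be a matching covered graph. Let $H'$ be a non-spanning conformal subgraph of $G$ and let $H'' := G - V(H')$. Then \[ \operatorname{pf}(H') + \operatorname{pf}(H'') - 1 \leq \operatorname{pf}(G). \]
   Context: Graphs are finite and simple. Given an orientation $D$ of a graph $G$ with vertices enumerated $1,\dots,2m$ and a perfect matching $M$ of $G$, $\operatorname{sign}_D(M)\in\{1,-1\}$ is the sign of the permutation $\begin{pmatrix}1&2&\cdots&2m-1&2m\\ u_1&v_1&\cdots&u_m&v_m\end{pmatrix}$, where the edges of $M$ are $u_iv_i$, oriented in $D$ from $u_i$ to $v_i$ (this is independent of the order in which the edges are listed). For a positive integer $k$, a $k$-orientation of $G$ is a vector $\mathbf{D}=(D_1,\dots,D_k)$ of $k$ orientations of $G$. For a perfect matching $M$, $\mathbf{sign}_{\mathbf{D}}(M) := (\operatorname{sign}_{D_1}(M),\dots,\operatorname{sign}_{D_k}(M))$. The signature matrix $\mathbf{sign}_{\mathbf{D}}$ is the matrix whose rows are the vectors $\mathbf{sign}_{\mathbf{D}}(M)$, one row for each perfect matching $M$ of $G$. $\mathbf{D}$ is pfaffian if the system $\mathbf{sign}_{\mathbf{D}}\,\mathbf{x}=\mathbf{1}$ has a solution $\mathbf{x}\in\mathbb{R}^k$. $G$ is $k$-pfaffian if it admits a pfaffian $k$-orientation; this does not depend on the enumeration of the vertices. The pfaffian number $\operatorname{pf}(G)$ is the smallest positive integer $k$ such that $G$ is $k$-pfaffian (it always exists). A graph is matchable if it has a perfect matching. A graph is matching covered if it is connected, has at least one edge, and every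 edge lies in some perfect matching. A subgraph $H$ of $G$ is conformal if both $H$ and $G-V(H)$ are matchable. $H'$ is non-spanning if $V(H')\ne V(G)$. *)

theory Defs
  imports Complex_Main "HOL-Combinatorics.Permutations"
begin

record 'a ugraph =
  verts :: "'a set"
  edges :: "'a set set"

definition simple_graph :: "'a ugraph \<Rightarrow> bool" where
  "simple_graph G \<longleftrightarrow> finite (verts G) \<and> (\<forall>e\<in>edges G. e \<subseteq> verts G \<and> card e = 2)"

definition subgraph :: "'a ugraph \<Rightarrow> 'a ugraph \<Rightarrow> bool" where
  "subgraph H G \<longleftrightarrow> simple_graph H \<and> verts H \<subseteq> verts G \<and> edges H \<subseteq> edges G"

definition del_verts :: "'a ugraph \<Rightarrow> 'a set \<Rightarrow> 'a ugraph" where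
  "del_verts G X = \<lparr>verts = verts G - X, edges = {e \<in> edges G. e \<inter> X = {}}\<rparr>"

definition connected_graph :: "'a ugraph \<Rightarrow> bool" where
  "connected_graph G \<longleftrightarrow> verts G \<noteq> {} \<and>
     (\<forall>u\<in>verts G. \<forall>v\<in>verts G. (u, v) \<in> {(x, y). {x, y} \<in> edges G}\<^sup>*)"

definition perfect_matching :: "'a ugraph \<Rightarrow> 'a set set \<Rightarrow> bool" where
  "perfect_matching G M \<longleftrightarrow> M \<subseteq> edges G \<and> (\<forall>v\<in>verts G. \<exists>!e. e \<in> M \<and> v \<in> e)"

definition matchable :: "'a ugraph \<Rightarrow> bool" where
  "matchable G \<longleftrightarrow> (\<exists>M. perfect_matching G M)"

definition matching_covered :: "'a ugraph \<Rightarrow> bool" where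
  "matching_covered G \<longleftrightarrow> connected_graph G \<and> edges G \<noteq> {} \<and>
     (\<forall>e\<in>edges G. \<exists>M. perfect_matching G M \<and> e \<in> M)"

definition conformal :: "'a ugraph \<Rightarrow> 'a ugraph \<Rightarrow> bool" where
  "conformal H G \<longleftrightarrow> subgraph H G \<and> matchable H \<and> matchable (del_verts G (verts H))"

definition enumeration :: "'a ugraph \<Rightarrow> ('a \<Rightarrow> nat) \<Rightarrow> bool" where
  "enumeration G num \<longleftrightarrow> bij_betw num (verts G) {1..card (verts G)}"

(* An orientation is the set of its arcs (tail, head): one arc for each edge. *)
definition orientation :: "'a ugraph \<Rightarrow> ('a \<times> 'a) set \<Rightarrow> bool" where
  "orientation G D \<longleftrightarrow> bij_betw (\<lambda>(u, v). {u, v}) D (edges G)"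

definition lists_matching :: "('a \<times> 'a) set \<Rightarrow> 'a set set \<Rightarrow> ('a \<times> 'a) list \<Rightarrow> bool" where
  "lists_matching D M es \<longleftrightarrow> distinct es \<and> set es = {(u, v) \<in> D. {u, v} \<in> M}"

(* For es = [(u_1,v_1), ..., (u_m,v_m)]: maps 2j-1 to u_j and 2j to v_j, and fixes every number
   outside {1..2m}. *)
definition matching_perm :: "('a \<Rightarrow> nat) \<Rightarrow> ('a \<times> 'a) list \<Rightarrow> nat \<Rightarrow> nat" where
  "matching_perm num es i =
     (if i \<in> {1..2 * length es}
      then num ((if odd i then fst else snd) (es ! ((i - 1) div 2)))
      else i)"

(* The sign does not depend on the chosen listing: reordering the arcs changes the permutation
   by an even one. *)
definition matching_sign :: "('a \<Rightarrow> nat) \<Rightarrow> ('a \<times> 'a) set \<Rightarrow> 'a set set \<Rightarrow> int" where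
  "matching_sign num D M = sign (matching_perm num (SOME es. lists_matching D M es))"

definition k_orientation :: "'a ugraph \<Rightarrow> nat \<Rightarrow> ('a \<times> 'a) set list \<Rightarrow> bool" where
  "k_orientation G k Ds \<longleftrightarrow> k \<ge> 1 \<and> length Ds = k \<and> (\<forall>D\<in>set Ds. orientation G D)"

(* The signature matrix: row M, column i < length Ds. Only rows indexed by perfect matchings of
   the graph are used. *)
definition signature_matrix ::
    "('a \<Rightarrow> nat) \<Rightarrow> ('a \<times> 'a) set list \<Rightarrow> 'a set set \<Rightarrow> nat \<Rightarrow> real" where
  "signature_matrix num Ds M i = of_int (matching_sign num (Ds ! i) M)"

definition pfaffian :: "'a ugraph \<Rightarrow> ('a \<Rightarrow> nat) \<Rightarrow> ('a \<times> 'a) set list \<Rightarrow> bool" where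
  "pfaffian G num Ds \<longleftrightarrow>
     (\<exists>x :: nat \<Rightarrow> real. \<forall>M. perfect_matching G M \<longrightarrow>
        (\<Sum>i<length Ds. signature_matrix num Ds M i * x i) = 1)"

(* Renumbering the vertices multiplies all signs by one common factor, so it does not matter
   which enumeration is used. *)
definition k_pfaffian :: "'a ugraph \<Rightarrow> nat \<Rightarrow> bool" where
  "k_pfaffian G k \<longleftrightarrow>
     (\<exists>num Ds. enumeration G num \<and> k_orientation G k Ds \<and> pfaffian G num Ds)"

definition pf :: "'a ugraph \<Rightarrow> nat" where
  "pf G = (LEAST k. k \<ge> 1 \<and> k_pfaffian G k)"

end

theory Submission
  imports Defs
begin

text \<open>
  Let \<open>k = pf G\<close> and take a pfaffian \<open>k\<close>-orientation of \<open>G\<close>, with solution \<open>x\<close>. If \<open>M\<close> and \<open>N\<close> are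
  perfect matchings of \<open>H'\<close> and \<open>H''\<close>, then \<open>M \<union> N\<close> is one of \<open>G\<close>, and for every orientation its
  sign is the product of the signs of \<open>M\<close> and \<open>N\<close> under the restricted orientations and of a constant
  \<open>\<gamma>\<close> that depends on the numberings only (\<open>matching_sign_Un\<close>). Writing \<open>a M i\<close> and \<open>b N i\<close> for the
  entries of the two restricted signature matrices, one obtains
  \<open>(\<Sum>i<k. \<gamma> * x i * a M i * b N i) = 1\<close> for all \<open>M\<close> and \<open>N\<close>.

  The rest is linear algebra (\<open>bilinear_system_split\<close>). Choose a set \<open>J\<close> of columns of \<open>b\<close> that is a
  basis of the column space, say \<open>b i = (\<Sum>j\<in>J. c i j * b j)\<close>. By the system, the all-ones vector is a
  combination of these columns, with coefficients \<open>w j\<close>, so \<open>H''\<close> is \<open>card J\<close>-pfaffian. As the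
  coefficients are unique, \<open>(\<Sum>i<k. y i * c i j * a M i) = w j\<close> for every \<open>j \<in> J\<close> and every \<open>M\<close>, where
  \<open>y i = \<gamma> * x i\<close>. Some \<open>w j\<close> is nonzero, and since \<open>c i j = 0\<close> for
  \<open>i \<in> J - {j}\<close>, dividing by it expresses the all-ones vector by the columns of \<open>a\<close> outside
  \<open>J - {j}\<close>. Hence \<open>H'\<close> is \<open>(k - card J + 1)\<close>-pfaffian, and the two bounds add up to \<open>k + 1\<close>.

  Two supporting facts need proof. The sign of a permutation is the product of the signs of all
  differences \<open>p j - p i\<close> with \<open>i < j\<close>; from this formula one reads off that the sign of a matching
  does not depend on the listing of its arcs, how it changes when arcs are reversed, and how it
  factors over disjoint unions. Moreover, \<open>pf G\<close> is defined as a least number, so some \<open>k\<close> must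
  exist for which \<open>G\<close> is \<open>k\<close>-pfaffian: reversing a set \<open>S\<close> of edges multiplies the sign of \<open>M\<close> by
  \<open>(-1) ^ card (S \<inter> M)\<close>, and by the orthogonality of these characters the all-ones vector is a
  combination of the sign vectors of all orientations (\<open>exists_k_pfaffian\<close>).
\<close>

section \<open>The sign of a permutation as a product over pairs\<close>

text \<open>The sign of the difference \<open>b - a\<close> (zero for equal numbers).\<close>
definition order_sgn :: "nat \<Rightarrow> nat \<Rightarrow> int" where
  "order_sgn a b = sgn (int b - int a)"

lemma order_sgn_swap: "order_sgn b a = - order_sgn a b"
  unfolding order_sgn_def by (simp add: sgn_if)

definition pairs_upto :: "nat \<Rightarrow> (nat \<times> nat) set" where
  "pairs_upto n = {(i, j). 1 \<le> i \<and> i < j \<and> j \<le> n}"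

lemma finite_pairs_upto [simp]: "finite (pairs_upto n)"
  by (rule finite_subset[of _ "{1..n} \<times> {1..n}"]) (auto simp: pairs_upto_def)

text \<open>\<open>-1\<close> to the number of inversions of \<open>p\<close> on \<open>{1..n}\<close>, provided that \<open>p\<close> is injective there.\<close>
definition inversion_product :: "nat \<Rightarrow> (nat \<Rightarrow> nat) \<Rightarrow> int" where
  "inversion_product n p = (\<Prod>(i, j)\<in>pairs_upto n. order_sgn (p i) (p j))"

text \<open>The permutation \<open>q\<close> acts on the pairs \<open>i < j\<close> by sending them to the sorted pair of images;
  each pair whose images must be exchanged contributes a factor \<open>-1\<close>, and these factors make up
  the inversion product of \<open>q\<close>.\<close>
lemma inversion_product_compose:
  assumes q: "q permutes {1..n}"
  shows "inversion_product n (p \<circ> q) = inversion_product n p * inversion_product n q"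
proof -
  define sort where "sort = (\<lambda>(i::nat, j::nat). (min i j, max i j))"
  define \<phi> where "\<phi> r = (\<lambda>(i, j). sort (r i, r j))" for r :: "nat \<Rightarrow> nat"
  have ne: "r i \<noteq> r j" if "r permutes {1..n}" "i \<noteq> j" for r i j
    using that permutes_inj[of r] by (auto simp: inj_def)
  have mem: "\<phi> r x \<in> pairs_upto n" if r: "r permutes {1..n}" and x: "x \<in> pairs_upto n" for r x
  proof -
    obtain i j where ij: "x = (i, j)" "1 \<le> i" "i < j" "j \<le> n"
      using x by (auto simp: pairs_upto_def)
    have "r i \<in> {1..n}" "r j \<in> {1..n}"
      using ij permutes_in_image[OF r] by auto
    moreover have "r i \<noteq> r j" using ne[OF r] ij by auto
    ultimately show ?thesis by (auto simp: ij \<phi>_def sort_def pairs_upto_def min_def max_def)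
  qed
  have inv: "\<phi> r' (\<phi> r x) = x"
    if "\<And>z. r' (r z) = z" "x \<in> pairs_upto n" for r r' x
    using that by (auto simp: \<phi>_def sort_def pairs_upto_def min_def max_def split: prod.splits)
  have iq: "inv q permutes {1..n}" by (rule permutes_inv[OF q])
  have q1: "inv q (q z) = z" and q2: "q (inv q z) = z" for z
    using permutes_inverses[OF q] by auto
  have bij: "bij_betw (\<phi> q) (pairs_upto n) (pairs_upto n)"
    by (rule bij_betw_byWitness[of _ "\<phi> (inv q)"])
      (use mem[OF q] mem[OF iq] inv[of "inv q" q] inv[of q "inv q"] q1 q2 in auto)
  have "inversion_product n (p \<circ> q) =
      (\<Prod>x\<in>pairs_upto n. (case \<phi> q x of (i, j) \<Rightarrow> order_sgn (p i) (p j)) *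
         (case x of (i, j) \<Rightarrow> order_sgn (q i) (q j)))"
    unfolding inversion_product_def
  proof (rule prod.cong[OF refl], clarify)
    fix i j assume ij: "(i, j) \<in> pairs_upto n"
    then have "q i \<noteq> q j" using ne[OF q] by (auto simp: pairs_upto_def)
    then consider "q i < q j" | "q j < q i" by linarith
    then show "order_sgn ((p \<circ> q) i) ((p \<circ> q) j) =
       (case \<phi> q (i, j) of (i, j) \<Rightarrow> order_sgn (p i) (p j)) * order_sgn (q i) (q j)"
    proof cases
      case 1
      then show ?thesis by (simp add: \<phi>_def sort_def order_sgn_def[of "q i"])
    next
      case 2
      then show ?thesis using order_sgn_swap[of "p (q j)" "p (q i)"]
        by (simp add: \<phi>_def sort_def order_sgn_def[of "q i"])
    qed
  qed
  also have "\<dots> = inversion_product n p * inversion_product n q"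
    unfolding inversion_product_def prod.distrib
    by (subst prod.reindex_bij_betw[OF bij]) simp
  finally show ?thesis .
qed

text \<open>The inversions of the transposition of \<open>a < b\<close> are \<open>(a, b)\<close> and, for every \<open>c\<close> strictly in between,
  \<open>(a, c)\<close> and \<open>(c, b)\<close>. Their number is odd.\<close>
lemma inversion_product_transpose:
  assumes ab: "1 \<le> a" "a < b" "b \<le> n"
  shows "inversion_product n (transpose a b) = -1"
proof -
  let ?A = "(\<lambda>c. (a, c)) ` {a<..<b}" and ?B = "(\<lambda>c. (c, b)) ` {a<..<b}"
  let ?I = "{(a, b)} \<union> (?A \<union> ?B)"
  have sub: "?I \<subseteq> pairs_upto n"
    using ab by (auto simp: pairs_upto_def)
  have "inversion_product n (transpose a b) =
      (\<Prod>x\<in>?I. case x of (i, j) \<Rightarrow> order_sgn (transpose a b i) (transpose a b j))"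
    unfolding inversion_product_def
  proof (rule prod.mono_neutral_right[OF finite_pairs_upto sub], rule ballI)
    fix x assume "x \<in> pairs_upto n - ?I"
    moreover obtain i j where "x = (i, j)" by fastforce
    ultimately show "(case x of (i, j) \<Rightarrow> order_sgn (transpose a b i) (transpose a b j)) = 1"
      using ab by (auto simp: order_sgn_def pairs_upto_def transpose_def sgn_if image_iff split: if_splits)
  qed
  also have "\<dots> = (\<Prod>x\<in>?I. -1)"
  proof (rule prod.cong[OF refl])
    fix x assume "x \<in> ?I"
    then show "(case x of (i, j) \<Rightarrow> order_sgn (transpose a b i) (transpose a b j)) = - 1"
      using ab by (auto simp: order_sgn_def transpose_def sgn_if)
  qed
  also have "\<dots> = (-1) ^ card ?I" by simp
  also have "card ?I = 1 + (card ?A + card ?B)"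
    by (subst card_Un_disjoint; (subst card_Un_disjoint)?) auto
  also have "card ?A + card ?B = 2 * (b - Suc a)"
    by (subst (1 2) card_image) (auto simp: inj_on_def)
  finally show ?thesis by simp
qed

lemma sign_eq_inversion_product:
  assumes "p permutes {1..n}"
  shows "sign p = inversion_product n p"
proof -
  have "finite {1..n}" by simp
  from this assms show ?thesis
  proof (induction rule: permutes_rev_induct)
    case id
    then show ?case
      unfolding inversion_product_def
      by (subst prod.neutral) (auto simp: pairs_upto_def order_sgn_def)
  next
    case (swap a b p)
    have t: "transpose a b permutes {1..n}"
      using swap by (intro permutes_swap_id) auto
    have "inversion_product n (transpose a b) = -1"
      using swap inversion_product_transpose[of a b n] inversion_product_transpose[of b a n]
      by (cases "a < b") (auto simp: transpose_commute)
    moreover have "permutation p" using swap permutation_permutes by blast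
    then have "sign (p \<circ> transpose a b) = sign p * sign (transpose a b)"
      by (rule sign_compose) (rule permutation_swap_id)
    ultimately show ?case
      using swap.hyps swap.IH by (simp only: inversion_product_compose[OF t] sign_swap_id if_False)
  qed
qed

section \<open>The sign of a listing of the vertices\<close>

text \<open>For a listing of distinctly numbered vertices this is \<open>-1\<close> to the number of pairs that are listed
  against the order of their numbers. If the numbers are \<open>1, \<dots>, n\<close>, it is the sign of the
  permutation with bottom row \<open>map num xs\<close>. Other numbers are permitted, so that a listing of the
  vertices of a subgraph can be treated with the numbering of the whole graph.\<close>
primrec order_sign :: "('a \<Rightarrow> nat) \<Rightarrow> 'a list \<Rightarrow> int" where
  "order_sign num [] = 1"
| "order_sign num (x # xs) = (\<Prod>y\<leftarrow>xs. order_sgn (num x) (num y)) * order_sign num xs"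

lemma prod_list_mult_distrib:
  fixes f g :: "'a \<Rightarrow> 'b :: comm_monoid_mult"
  shows "(\<Prod>x\<leftarrow>xs. f x * g x) = (\<Prod>x\<leftarrow>xs. f x) * (\<Prod>x\<leftarrow>xs. g x)"
  by (induction xs) (simp_all add: ac_simps)

lemma order_sign_append:
  "order_sign num (xs @ ys) =
     order_sign num xs * order_sign num ys * (\<Prod>x\<leftarrow>xs. \<Prod>y\<leftarrow>ys. order_sgn (num x) (num y))"
  by (induction xs) (simp_all add: ac_simps)

lemma order_sign_snoc:
  "order_sign num (xs @ [y]) = order_sign num xs * (\<Prod>x\<leftarrow>xs. order_sgn (num x) (num y))"
  by (simp add: order_sign_append)

lemma inversion_product_nth:
  "inversion_product (length xs) (\<lambda>i. num (xs ! (i - 1))) = order_sign num xs"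
proof (induction xs rule: rev_induct)
  case Nil
  then show ?case by (auto simp: inversion_product_def pairs_upto_def intro!: prod.neutral)
next
  case (snoc y xs)
  let ?n = "length xs" and ?new = "(\<lambda>i. (Suc i, Suc (length xs))) ` {..<length xs}"
  have split: "pairs_upto (Suc ?n) = pairs_upto ?n \<union> ?new"
  proof
    show "pairs_upto (Suc ?n) \<subseteq> pairs_upto ?n \<union> ?new"
    proof clarify
      fix i j assume *: "(i, j) \<in> pairs_upto (Suc ?n)" "(i, j) \<notin> ?new"
      show "(i, j) \<in> pairs_upto ?n"
      proof (rule ccontr)
        assume "(i, j) \<notin> pairs_upto ?n"
        with * have "(i, j) = (Suc (i - 1), Suc ?n)" "i - 1 < ?n"
          by (auto simp: pairs_upto_def)
        then have "(i, j) \<in> ?new" by blast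
        with * show False by simp
      qed
    qed
  qed (auto simp: pairs_upto_def)
  have "inversion_product (Suc ?n) (\<lambda>i. num ((xs @ [y]) ! (i - 1))) =
     (\<Prod>(i, j)\<in>pairs_upto ?n. order_sgn (num ((xs @ [y]) ! (i - 1))) (num ((xs @ [y]) ! (j - 1)))) *
     (\<Prod>(i, j)\<in>?new. order_sgn (num ((xs @ [y]) ! (i - 1))) (num ((xs @ [y]) ! (j - 1))))"
    unfolding inversion_product_def split
    by (rule prod.union_disjoint[OF finite_pairs_upto]) (auto simp: pairs_upto_def)
  also have "(\<Prod>(i, j)\<in>pairs_upto ?n. order_sgn (num ((xs @ [y]) ! (i - 1))) (num ((xs @ [y]) ! (j - 1)))) =
      inversion_product ?n (\<lambda>i. num (xs ! (i - 1)))"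
    unfolding inversion_product_def
    by (rule prod.cong) (auto simp: pairs_upto_def nth_append)
  also have "(\<Prod>(i, j)\<in>?new. order_sgn (num ((xs @ [y]) ! (i - 1))) (num ((xs @ [y]) ! (j - 1)))) =
      (\<Prod>i<?n. order_sgn (num (xs ! i)) (num y))"
    by (subst prod.reindex) (auto simp: inj_on_def nth_append intro!: prod.cong)
  also have "\<dots> = (\<Prod>x\<leftarrow>xs. order_sgn (num x) (num y))"
    by (simp add: prod.list_conv_set_nth atLeast0LessThan)
  finally show ?case by (simp only: snoc order_sign_snoc length_append_singleton)
qed

section \<open>Listings of arcs\<close>

text \<open>The vertices \<open>u\<^sub>1, v\<^sub>1, u\<^sub>2, v\<^sub>2, \<dots>\<close> in the order in which a list of arcs mentions them.\<close>
definition ends :: "('a \<times> 'a) list \<Rightarrow> 'a list" where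
  "ends es = concat (map (\<lambda>(u, v). [u, v]) es)"

lemma ends_simps [simp]:
  "ends [] = []" "ends ((u, v) # es) = u # v # ends es" "ends (es @ fs) = ends es @ ends fs"
  by (simp_all add: ends_def)

lemma length_ends [simp]: "length (ends es) = 2 * length es"
  by (induction es) auto

lemma set_ends: "set (ends es) = (\<Union>(u, v)\<in>set es. {u, v})"
  by (induction es) auto

lemma nth_ends:
  assumes "k < 2 * length es"
  shows "ends es ! k = (if even k then fst else snd) (es ! (k div 2))"
  using assms
proof (induction es arbitrary: k)
  case (Cons a es)
  obtain u v where a: "a = (u, v)" by fastforce
  consider "k = 0" | "k = 1" | k' where "k = Suc (Suc k')"
    by (metis One_nat_def not0_implies_Suc)
  then show ?case
    using Cons by cases (auto simp: a)
qed simp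

lemma order_sign_swap:
  "order_sign num (v # u # xs) = - order_sign num (u # v # xs)"
  by (simp add: order_sgn_swap[of "num u" "num v"] ac_simps)

text \<open>Moving an arc past a vertex changes two signs, one for each end of the arc.\<close>
lemma order_sign_ends_move:
  "order_sign num (ends (es @ a # fs)) = order_sign num (ends (a # es @ fs))"
proof -
  obtain u v where a: "a = (u, v)" by fastforce
  have 1: "(\<Prod>x\<leftarrow>xs. order_sgn (num x) (num u) * order_sgn (num x) (num v)) =
     (\<Prod>x\<leftarrow>xs. order_sgn (num u) (num x)) * (\<Prod>x\<leftarrow>xs. order_sgn (num v) (num x))" for xs
    unfolding prod_list_mult_distrib[symmetric]
    by (subst order_sgn_swap, subst (2) order_sgn_swap) simp
  show ?thesis
    by (simp add: a order_sign_append prod_list_mult_distrib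
        1[unfolded prod_list_mult_distrib] ac_simps) 
qed

lemma prod_list_ends:
  fixes f :: "'a \<Rightarrow> 'b :: comm_monoid_mult"
  assumes "distinct es"
  shows "(\<Prod>x\<leftarrow>ends es. f x) = (\<Prod>a\<in>set es. f (fst a) * f (snd a))"
  using assms by (induction es) (auto simp: ac_simps)

text \<open>The sign of a matching does not depend on the order in which its arcs are listed.\<close>
lemma order_sign_ends_permute:
  assumes "distinct es" "distinct fs" "set es = set fs"
  shows "order_sign num (ends es) = order_sign num (ends fs)"
  using assms
proof (induction es arbitrary: fs)
  case (Cons a es)
  obtain p q where fs: "fs = p @ a # q"
    using Cons.prems(3) by (metis list.set_intros(1) split_list)
  have pq: "distinct (p @ q)" "set es = set (p @ q)"
    using Cons.prems fs by auto
  obtain u v where a: "a = (u, v)" by fastforce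
  have "distinct es" using Cons.prems(1) by simp
  then have eq: "(\<Prod>y\<leftarrow>ends es. f y) = (\<Prod>y\<leftarrow>ends (p @ q). f y)" for f :: "'a \<Rightarrow> int"
    using pq by (simp only: prod_list_ends)
  have IH: "order_sign num (ends es) = order_sign num (ends (p @ q))"
    by (rule Cons.IH) (use \<open>distinct es\<close> pq in simp_all)
  show ?case
    unfolding fs order_sign_ends_move by (simp add: a eq IH del: ends_simps(3))
qed auto

section \<open>Signs of perfect matchings\<close>

lemma distinct_ends:
  assumes "distinct es" "\<And>u v. (u, v) \<in> set es \<Longrightarrow> u \<noteq> v"
    and "\<And>u v u' v'. (u, v) \<in> set es \<Longrightarrow> (u', v') \<in> set es \<Longrightarrow> (u, v) \<noteq> (u', v')
           \<Longrightarrow> {u, v} \<inter> {u', v'} = {}"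
  shows "distinct (ends es)"
  using assms
proof (induction es)
  case (Cons a es)
  obtain u v where a: "a = (u, v)" by fastforce
  have IH: "distinct (ends es)"
    by (rule Cons.IH) (use Cons.prems in \<open>auto simp del: insert_disjoint disjoint_insert\<close>)
  have "{u, v} \<inter> {u', v'} = {}" if "(u', v') \<in> set es" for u' v'
    using Cons.prems(1) Cons.prems(3)[of u v u' v'] that a by auto
  then have "u \<notin> set (ends es)" "v \<notin> set (ends es)"
    by (auto simp: set_ends)
  then show ?case using IH Cons.prems(2)[of u v] by (auto simp: a)
qed simp

lemma simple_graph_edgeD:
  assumes "simple_graph H" "{u, v} \<in> edges H"
  shows "u \<noteq> v" "u \<in> verts H" "v \<in> verts H"
  using assms by (auto simp: simple_graph_def)

lemma finite_edges:
  assumes "simple_graph H"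
  shows "finite (edges H)"
  using assms by (intro finite_subset[of "edges H" "Pow (verts H)"]) (auto simp: simple_graph_def)

lemma finite_orientation:
  assumes "simple_graph H" "orientation H D"
  shows "finite D"
proof -
  have "finite D \<longleftrightarrow> finite (edges H)"
    by (rule bij_betw_finite) (use assms(2) in \<open>simp add: orientation_def\<close>)
  then show ?thesis using finite_edges[OF assms(1)] by simp
qed

lemma exists_lists_matching:
  assumes "simple_graph H" "orientation H D"
  obtains es where "lists_matching D M es"
proof -
  have "finite {(u, v) \<in> D. {u, v} \<in> M}"
    using finite_orientation[OF assms] by (rule rev_finite_subset) auto
  then obtain es where "set es = {(u, v) \<in> D. {u, v} \<in> M}" "distinct es"
    by (auto dest: finite_distinct_list)
  then show ?thesis by (intro that) (simp add: lists_matching_def)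
qed

lemma orientation_arc_eq:
  assumes "orientation H D" "(u, v) \<in> D" "(u', v') \<in> D" "{u, v} = {u', v'}"
  shows "(u, v) = (u', v')"
proof (rule inj_onD)
  show "inj_on (\<lambda>(u, v). {u, v}) D"
    using assms(1) by (simp add: orientation_def bij_betw_def)
qed (use assms in auto)

lemma lists_matching_edge_bij:
  assumes "orientation H D" "M \<subseteq> edges H" "lists_matching D M es"
  shows "bij_betw (\<lambda>(u, v). {u, v}) (set es) M"
proof -
  have "inj_on (\<lambda>(u, v). {u, v}) (set es)"
    using assms unfolding orientation_def bij_betw_def lists_matching_def
    by (auto elim!: inj_on_subset)
  moreover have "(\<lambda>(u, v). {u, v}) ` set es = M"
  proof
    show "M \<subseteq> (\<lambda>(u, v). {u, v}) ` set es"
    proof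
      fix e assume e: "e \<in> M"
      then have "e \<in> (\<lambda>(u, v). {u, v}) ` D"
        using assms unfolding orientation_def bij_betw_def by auto
      then show "e \<in> (\<lambda>(u, v). {u, v}) ` set es"
        using assms(3) e unfolding lists_matching_def by auto
    qed
  qed (use assms(3) in \<open>auto simp: lists_matching_def\<close>)
  ultimately show ?thesis by (simp add: bij_betw_def)
qed

lemma ends_perfect_matching:
  assumes H: "simple_graph H" and D: "orientation H D"
    and M: "perfect_matching H M" and es: "lists_matching D M es"
  shows "distinct (ends es)" "set (ends es) = verts H"
proof -
  have sub: "M \<subseteq> edges H" and un: "\<And>v. v \<in> verts H \<Longrightarrow> \<exists>!e. e \<in> M \<and> v \<in> e"
    using M by (auto simp: perfect_matching_def)
  have setes: "(u, v) \<in> set es \<longleftrightarrow> (u, v) \<in> D \<and> {u, v} \<in> M" for u v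
    using es by (auto simp: lists_matching_def)
  show "distinct (ends es)"
  proof (rule distinct_ends)
    show "distinct es" using es by (simp add: lists_matching_def)
    show "u \<noteq> v" if "(u, v) \<in> set es" for u v
      using that sub setes simple_graph_edgeD(1)[OF H] by blast
    show "{u, v} \<inter> {u', v'} = {}"
      if "(u, v) \<in> set es" "(u', v') \<in> set es" "(u, v) \<noteq> (u', v')" for u v u' v'
    proof (rule ccontr)
      assume "{u, v} \<inter> {u', v'} \<noteq> {}"
      then obtain w where w: "w \<in> {u, v}" "w \<in> {u', v'}" by blast
      have e: "{u, v} \<in> M" "{u', v'} \<in> M" using that setes by auto
      moreover have "w \<in> verts H"
        using w(1) e(1) sub simple_graph_edgeD(2,3)[OF H, of u v] by auto
      ultimately have "{u, v} = {u', v'}" using un[of w] w by (metis (no_types))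
      then have "(u, v) = (u', v')"
        using that(1,2) setes by (intro orientation_arc_eq[OF D]) auto
      then show False using that(3) by contradiction
    qed
  qed
  have "set (ends es) = \<Union> ((\<lambda>(u, v). {u, v}) ` set es)" by (simp add: set_ends)
  also have "\<dots> = \<Union> M"
    using lists_matching_edge_bij[OF D sub es] by (simp add: bij_betw_def)
  also have "\<dots> = verts H"
  proof
    show "\<Union> M \<subseteq> verts H"
      using sub H by (auto simp: simple_graph_def)
    show "verts H \<subseteq> \<Union> M"
    proof
      fix v assume "v \<in> verts H"
      then obtain e where "e \<in> M" "v \<in> e" using un by (meson ex1E)
      then show "v \<in> \<Union> M" by (rule UnionI)
    qed
  qed
  finally show "set (ends es) = verts H" .
qed

lemma matching_perm_eq_nth_ends:
  "i \<in> {1..2 * length es} \<Longrightarrow> matching_perm num es i = num (ends es ! (i - 1))"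
  by (auto simp: matching_perm_def nth_ends)

lemma matching_perm_permutes:
  assumes "bij_betw num (set (ends es)) {1..2 * length es}" "distinct (ends es)"
  shows "matching_perm num es permutes {1..2 * length es}"
proof (rule bij_imp_permutes)
  let ?n = "2 * length es"
  have "bij_betw (\<lambda>i. i - 1) {1..?n} {..<?n}"
    by (rule bij_betw_byWitness[of _ Suc]) auto
  moreover have "bij_betw (\<lambda>i. ends es ! i) {..<?n} (set (ends es))"
    using bij_betw_nth[OF assms(2)] by simp
  ultimately have "bij_betw (num \<circ> ((\<lambda>i. ends es ! i) \<circ> (\<lambda>i. i - 1))) {1..?n} {1..?n}"
    using assms(1) by (rule bij_betw_trans[OF bij_betw_trans])
  then show "bij_betw (matching_perm num es) {1..?n} {1..?n}"
    by (subst bij_betw_cong) (auto simp: matching_perm_eq_nth_ends)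
qed (auto simp only: matching_perm_def if_False)

text \<open>This replaces the arbitrary listing chosen in the definition of the sign by any given one.\<close>
lemma matching_sign_eq_order_sign:
  assumes H: "simple_graph H" and D: "orientation H D" and num: "enumeration H num"
    and M: "perfect_matching H M" and es: "lists_matching D M es"
  shows "matching_sign num D M = order_sign num (ends es)"
proof -
  define fs where "fs = (SOME fs. lists_matching D M fs)"
  have fs: "lists_matching D M fs"
    unfolding fs_def using es by (rule someI)
  note e = ends_perfect_matching[OF H D M fs]
  have card: "card (verts H) = 2 * length fs"
    using distinct_card[OF e(1)] by (simp add: e(2))
  have perm: "matching_perm num fs permutes {1..2 * length fs}"
    using matching_perm_permutes[of num fs] e num card by (simp add: enumeration_def)
  have "matching_sign num D M = sign (matching_perm num fs)"
    by (simp add: matching_sign_def fs_def)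
  also have "\<dots> = inversion_product (2 * length fs) (matching_perm num fs)"
    by (rule sign_eq_inversion_product[OF perm])
  also have "\<dots> = inversion_product (length (ends fs)) (\<lambda>i. num (ends fs ! (i - 1)))"
    unfolding inversion_product_def
    by (rule prod.cong) (auto simp: pairs_upto_def matching_perm_eq_nth_ends)
  also have "\<dots> = order_sign num (ends fs)"
    by (rule inversion_product_nth)
  also have "\<dots> = order_sign num (ends es)"
    using fs es by (intro order_sign_ends_permute) (auto simp: lists_matching_def)
  finally show ?thesis .
qed

text \<open>A family of orientations over an arbitrary finite index set may serve in place of a list.\<close>
lemma k_pfaffianI:
  assumes num: "enumeration H num" and I: "finite I" "I \<noteq> {}"
    and D: "\<And>i. i \<in> I \<Longrightarrow> orientation H (D i)"
    and x: "\<And>M. perfect_matching H M \<Longrightarrow> (\<Sum>i\<in>I. of_int (matching_sign num (D i) M) * x i) = (1::real)"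
  shows "k_pfaffian H (card I)"
proof -
  obtain f where f: "bij_betw f {0..<card I} I"
    using ex_bij_betw_nat_finite[OF I(1)] by blast
  let ?Ds = "map (D \<circ> f) [0..<card I]"
  have "k_orientation H (card I) ?Ds"
    using I D f by (auto simp: k_orientation_def Suc_le_eq card_gt_0_iff bij_betw_def)
  moreover have "pfaffian H num ?Ds"
    unfolding pfaffian_def
  proof (intro exI allI impI)
    fix M assume M: "perfect_matching H M"
    have "(\<Sum>i<length ?Ds. signature_matrix num ?Ds M i * (x \<circ> f) i) =
       (\<Sum>i\<in>{0..<card I}. of_int (matching_sign num (D (f i)) M) * x (f i))"
      by (rule sum.cong) (auto simp: signature_matrix_def)
    also have "\<dots> = (\<Sum>i\<in>I. of_int (matching_sign num (D i) M) * x i)"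
      by (rule sum.reindex_bij_betw[OF f])
    finally show "(\<Sum>i<length ?Ds. signature_matrix num ?Ds M i * (x \<circ> f) i) = 1"
      using x[OF M] by simp
  qed
  ultimately show ?thesis using num unfolding k_pfaffian_def by blast
qed

lemma pf_le:
  assumes "k_pfaffian H k"
  shows "pf H \<le> k"
proof -
  have "k \<ge> 1" using assms by (auto simp: k_pfaffian_def k_orientation_def)
  then show ?thesis unfolding pf_def using assms by (intro Least_le) simp
qed

section \<open>Splitting a bilinear system\<close>

text \<open>The matrix \<open>a diag(y) b\<^sup>T\<close> consists of ones, where the rows of \<open>a\<close> and \<open>b\<close> are indexed by \<open>R\<close> and \<open>S\<close>.
  The set \<open>J\<close> in the proof indexes a basis of the column space of \<open>b\<close>; it is obtained as a
  spanning set of columns of least cardinality.\<close>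
lemma bilinear_system_split:
  fixes a :: "'m \<Rightarrow> nat \<Rightarrow> real" and b :: "'n \<Rightarrow> nat \<Rightarrow> real" and y :: "nat \<Rightarrow> real"
  assumes ne: "R \<noteq> {}" "S \<noteq> {}"
    and sys: "\<And>M N. M \<in> R \<Longrightarrow> N \<in> S \<Longrightarrow> (\<Sum>i<k. y i * a M i * b N i) = 1"
  obtains I J x z where "I \<subseteq> {..<k}" "J \<subseteq> {..<k}" "I \<noteq> {}" "J \<noteq> {}" "card I + card J = k + 1"
    "\<And>M. M \<in> R \<Longrightarrow> (\<Sum>i\<in>I. a M i * x i) = 1"
    "\<And>N. N \<in> S \<Longrightarrow> (\<Sum>j\<in>J. b N j * z j) = 1"
proof -
  define spanning where "spanning J \<longleftrightarrow> J \<subseteq> {..<k} \<and>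
    (\<exists>c. \<forall>i<k. \<forall>N\<in>S. b N i = (\<Sum>j\<in>J. c i j * b N j))" for J
  have "spanning {..<k}"
    unfolding spanning_def
  proof (intro conjI exI allI impI ballI)
    fix i N assume i: "i < k"
    have "(\<Sum>j<k. of_bool (i = j) * b N j) = (\<Sum>j<k. if i = j then b N j else 0)"
      by (intro sum.cong) auto
    then show "b N i = (\<Sum>j<k. of_bool (i = j) * b N j)" using i by simp
  qed simp
  then obtain J where J: "spanning J" and min: "\<And>J'. spanning J' \<Longrightarrow> card J \<le> card J'"
    using ex_has_least_nat[of spanning "{..<k}" card] by blast
  have Jk: "J \<subseteq> {..<k}" and fin: "finite J"
    using J finite_subset by (auto simp: spanning_def)
  obtain c0 where c0: "\<And>i N. i < k \<Longrightarrow> N \<in> S \<Longrightarrow> b N i = (\<Sum>j\<in>J. c0 i j * b N j)"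
    using J by (auto simp: spanning_def)
  \<comment> \<open>The coefficients of the columns in \<open>J\<close> themselves are taken to be the obvious ones, so that
    \<open>c i j = 0\<close> for \<open>i \<in> J - {j}\<close>.\<close>
  define c where "c i j = (if i \<in> J then if i = j then 1 else 0 else c0 i j)" for i j
  have c: "b N i = (\<Sum>j\<in>J. c i j * b N j)" if "i < k" "N \<in> S" for i N
  proof (cases "i \<in> J")
    case True
    then have "(\<Sum>j\<in>J. c i j * b N j) = (\<Sum>j\<in>J. if i = j then b N j else 0)"
      by (intro sum.cong) (auto simp: c_def)
    then show ?thesis using True fin by simp
  qed (use c0[OF that] in \<open>simp add: c_def\<close>)
  \<comment> \<open>By minimality of \<open>J\<close>, its columns are linearly independent: a column in a nontrivial relation
    could be eliminated.\<close>
  have indep: "d j = 0" if d: "\<And>N. N \<in> S \<Longrightarrow> (\<Sum>j\<in>J. d j * b N j) = 0" and j: "j \<in> J" for d j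
  proof (rule ccontr)
    assume dj: "d j \<noteq> 0"
    have bj: "b N j = (\<Sum>l\<in>J - {j}. - d l / d j * b N l)" if N: "N \<in> S" for N
    proof -
      have "d j * b N j + (\<Sum>l\<in>J - {j}. d l * b N l) = 0"
        using d[OF N] sum.remove[OF fin j, of "\<lambda>l. d l * b N l"] by simp
      then have "b N j = - (\<Sum>l\<in>J - {j}. d l * b N l) / d j"
        using dj by (simp add: field_simps)
      also have "\<dots> = (\<Sum>l\<in>J - {j}. - d l / d j * b N l)"
        by (simp add: sum_divide_distrib sum_negf[symmetric])
      finally show ?thesis .
    qed
    have "spanning (J - {j})"
      unfolding spanning_def
    proof (intro conjI exI allI impI ballI)
      fix i N assume i: "i < k" and N: "N \<in> S"
      have "b N i = c i j * b N j + (\<Sum>l\<in>J - {j}. c i l * b N l)"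
        using c[OF i N] sum.remove[OF fin j, of "\<lambda>l. c i l * b N l"] by simp
      also have "\<dots> = (\<Sum>l\<in>J - {j}. c i j * (- d l / d j * b N l) + c i l * b N l)"
        by (subst bj[OF N]) (simp only: sum_distrib_left sum.distrib)
      also have "\<dots> = (\<Sum>l\<in>J - {j}. (c i j * (- d l / d j) + c i l) * b N l)"
        by (intro sum.cong) (auto simp: algebra_simps)
      finally show "b N i = (\<Sum>l\<in>J - {j}. (c i j * (- d l / d j) + c i l) * b N l)" .
    qed (use Jk in auto)
    then show False
      using min[of "J - {j}"] card_Diff1_less[OF fin j] by simp
  qed
  define w where "w M j = (\<Sum>i<k. y i * a M i * c i j)" for M j
  have w1: "(\<Sum>j\<in>J. w M j * b N j) = 1" if "M \<in> R" "N \<in> S" for M N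
  proof -
    have "(\<Sum>j\<in>J. w M j * b N j) = (\<Sum>j\<in>J. \<Sum>i<k. y i * a M i * (c i j * b N j))"
      by (simp add: w_def sum_distrib_right mult.assoc)
    also have "\<dots> = (\<Sum>i<k. y i * a M i * (\<Sum>j\<in>J. c i j * b N j))"
      by (subst sum.swap) (simp add: sum_distrib_left)
    also have "\<dots> = (\<Sum>i<k. y i * a M i * b N i)"
      by (intro sum.cong) (use c that in auto)
    finally show ?thesis using sys that by simp
  qed
  obtain M0 N0 where M0: "M0 \<in> R" and N0: "N0 \<in> S" using ne by blast
  \<comment> \<open>For every \<open>M\<close>, the numbers \<open>w M j\<close> are the coefficients of the all-ones vector over the columns
    in \<open>J\<close>; by independence they do not depend on \<open>M\<close>.\<close>
  have wM: "w M j = w M0 j" if "M \<in> R" "j \<in> J" for M j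
    using indep[of "\<lambda>j. w M j - w M0 j" j] w1 that M0 by (simp add: left_diff_distrib sum_subtractf)
  have "\<exists>j\<in>J. w M0 j \<noteq> 0"
  proof (rule ccontr)
    assume "\<not> (\<exists>j\<in>J. w M0 j \<noteq> 0)"
    then show False using w1[OF M0 N0] by simp
  qed
  then obtain j where j: "j \<in> J" "w M0 j \<noteq> 0" by blast
  let ?I = "{..<k} - (J - {j})"
  show ?thesis
  proof (rule that[of ?I J "\<lambda>i. y i * c i j / w M0 j" "w M0"])
    show "?I \<noteq> {}" "J \<noteq> {}" using j Jk by auto
    have "card ?I = k - (card J - 1)"
      using j Jk fin by (subst card_Diff_subset) auto
    moreover have "card J \<le> k" using card_mono[OF _ Jk] by simp
    moreover have "card J > 0" using j fin by (auto simp: card_gt_0_iff)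
    ultimately show "card ?I + card J = k + 1" by simp
    show "(\<Sum>i\<in>?I. a M i * (y i * c i j / w M0 j)) = 1" if M: "M \<in> R" for M
    proof -
      have "(\<Sum>i\<in>?I. a M i * (y i * c i j / w M0 j)) = (\<Sum>i<k. a M i * (y i * c i j / w M0 j))"
        by (rule sum.mono_neutral_left) (auto simp: c_def)
      also have "\<dots> = w M j / w M0 j"
        by (simp add: w_def sum_divide_distrib ac_simps)
      finally show ?thesis using wM[OF M] j by simp
    qed
    show "(\<Sum>j\<in>J. b N j * w M0 j) = 1" if "N \<in> S" for N
      using w1[OF M0 that] by (simp add: mult.commute)
  qed (use Jk in auto)
qed

section \<open>Reversing arcs, and the existence of pfaffian orientations\<close>

lemma sum_characters:
  fixes h :: "'e \<Rightarrow> real"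
  assumes "finite E"
  shows "(\<Sum>S\<in>Pow E. \<Prod>e\<in>S. h e) = (\<Prod>e\<in>E. 1 + h e)"
  using prod_add[OF assms, of h "\<lambda>_. 1"] by (simp add: add.commute)

text \<open>The character \<open>(-1) ^ card (S \<inter> M)\<close>, for finite \<open>S\<close>.\<close>
definition flip_char :: "'e set \<Rightarrow> 'e set \<Rightarrow> int" where
  "flip_char S M = (\<Prod>e\<in>S. if e \<in> M then -1 else 1)"

lemma flip_char_commute:
  fixes S M :: "'e set"
  assumes "finite S" "finite M"
  shows "flip_char S M = flip_char M S"
proof -
  have "flip_char A B = (-1) ^ card (A \<inter> B)" if "finite A" for A B :: "'e set"
    using that prod.inter_restrict[of A "\<lambda>_. -1 :: int" B] by (simp add: flip_char_def)
  then show ?thesis using assms by (simp add: Int_commute)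
qed

lemma flip_char_orthogonal:
  assumes "finite E" "M \<subseteq> E" "N \<subseteq> E"
  shows "(\<Sum>S\<in>Pow E. real_of_int (flip_char S M) * real_of_int (flip_char S N)) =
    (if M = N then 2 ^ card E else 0)"
proof -
  let ?h = "\<lambda>e. (if e \<in> M then -1 else 1) * (if e \<in> N then -1 else 1) :: real"
  have "(\<Sum>S\<in>Pow E. real_of_int (flip_char S M) * real_of_int (flip_char S N)) =
     (\<Sum>S\<in>Pow E. \<Prod>e\<in>S. ?h e)"
    unfolding flip_char_def of_int_prod prod.distrib[symmetric] by (intro sum.cong prod.cong) auto
  also have "\<dots> = (\<Prod>e\<in>E. 1 + ?h e)" by (rule sum_characters[OF assms(1)])
  also have "\<dots> = (if M = N then 2 ^ card E else 0)"
  proof (cases "M = N")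
    case True
    then have "(\<Prod>e\<in>E. 1 + ?h e) = (\<Prod>e\<in>E. 2)" by (intro prod.cong) auto
    then show ?thesis using True by simp
  next
    case False
    then obtain e where "e \<in> E" "(e \<in> M) \<noteq> (e \<in> N)" using assms by blast
    then have "\<exists>e\<in>E. 1 + ?h e = 0" by (intro bexI[of _ e]) auto
    then show ?thesis using False assms(1) by (simp add: prod_zero)
  qed
  finally show ?thesis .
qed

text \<open>Reverses an arc if its edge belongs to \<open>S\<close>.\<close>
definition flip_arc :: "'a set set \<Rightarrow> 'a \<times> 'a \<Rightarrow> 'a \<times> 'a" where
  "flip_arc S = (\<lambda>(u, v). if {u, v} \<in> S then (v, u) else (u, v))"

lemma prod_list_ends_flip:
  fixes f :: "'a \<Rightarrow> 'b :: comm_monoid_mult"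
  shows "(\<Prod>x\<leftarrow>ends (map (flip_arc S) es). f x) = (\<Prod>x\<leftarrow>ends es. f x)"
  by (induction es) (auto simp: flip_arc_def ac_simps split: prod.splits)

lemma order_sign_flip:
  "order_sign num (ends (map (flip_arc S) es)) =
     (\<Prod>(u, v)\<leftarrow>es. if {u, v} \<in> S then -1 else 1) * order_sign num (ends es)"
proof (induction es)
  case (Cons a es)
  obtain u v where a: "a = (u, v)" by fastforce
  show ?case
  proof (cases "{u, v} \<in> S")
    case True
    then have "order_sign num (ends (map (flip_arc S) (a # es))) =
        order_sign num (v # u # ends (map (flip_arc S) es))"
      by (simp add: a flip_arc_def del: order_sign.simps)
    also have "\<dots> = - order_sign num (u # v # ends (map (flip_arc S) es))"
      by (rule order_sign_swap)
    finally show ?thesis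
      using True by (simp add: a prod_list_ends_flip Cons.IH)
  next
    case False
    then have "flip_arc S (u, v) = (u, v)" by (simp add: flip_arc_def)
    then show ?thesis using False
      by (simp add: a prod_list_ends_flip Cons.IH)
  qed
qed simp

text \<open>The orientation in which every edge points to the end with the larger number, except that the
  edges in \<open>S\<close> are reversed.\<close>
definition flipped_orientation :: "'a ugraph \<Rightarrow> ('a \<Rightarrow> nat) \<Rightarrow> 'a set set \<Rightarrow> ('a \<times> 'a) set" where
  "flipped_orientation H num S =
     {(u, v). {u, v} \<in> edges H \<and> (if {u, v} \<in> S then num v < num u else num u < num v)}"

lemma orientation_flipped:
  assumes H: "simple_graph H" and num: "enumeration H num"
  shows "orientation H (flipped_orientation H num S)"
  unfolding orientation_def bij_betw_def
proof
  let ?D = "flipped_orientation H num S"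
  show "inj_on (\<lambda>(u, v). {u, v}) ?D"
  proof (rule inj_onI, clarify)
    fix u v u' v' assume *: "(u, v) \<in> ?D" "(u', v') \<in> ?D" "{u, v} = {u', v'}"
    then have "u = u' \<and> v = v' \<or> u = v' \<and> v = u'" by (auto simp: doubleton_eq_iff)
    moreover have "\<not> (u = v' \<and> v = u')"
      using * by (auto simp: flipped_orientation_def insert_commute split: if_splits)
    ultimately show "u = u' \<and> v = v'" by blast
  qed
  show "(\<lambda>(u, v). {u, v}) ` ?D = edges H"
  proof
    show "edges H \<subseteq> (\<lambda>(u, v). {u, v}) ` ?D"
    proof
      fix e assume e: "e \<in> edges H"
      then obtain u v where uv: "e = {u, v}" "u \<noteq> v" "u \<in> verts H" "v \<in> verts H"
        using H by (auto simp: simple_graph_def card_2_iff)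
      then have "num u \<noteq> num v"
        using num by (auto simp: enumeration_def bij_betw_def inj_on_def)
      then have "(u, v) \<in> ?D \<or> (v, u) \<in> ?D"
        using e uv(1) by (auto simp: flipped_orientation_def insert_commute)
      then show "e \<in> (\<lambda>(u, v). {u, v}) ` ?D"
        using uv(1) by (force simp: insert_commute)
    qed
  qed (auto simp: flipped_orientation_def)
qed

lemma matching_sign_flipped:
  assumes H: "simple_graph H" and num: "enumeration H num" and M: "perfect_matching H M"
    and S: "S \<subseteq> edges H"
  shows "matching_sign num (flipped_orientation H num S) M =
    flip_char S M * matching_sign num (flipped_orientation H num {}) M"
proof -
  let ?D = "flipped_orientation H num"
  note ori = orientation_flipped[OF H num]
  have sub: "M \<subseteq> edges H" using M by (simp add: perfect_matching_def)
  obtain es where es: "lists_matching (?D {}) M es"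
    using exists_lists_matching[OF H ori] .
  have bij: "bij_betw (\<lambda>(u, v). {u, v}) (set es) M"
    by (rule lists_matching_edge_bij[OF ori sub es])
  have involution: "flip_arc S (flip_arc S a) = a" for a
    by (auto simp: flip_arc_def insert_commute split: prod.splits)
  have mem: "(u, v) \<in> ?D S \<longleftrightarrow> flip_arc S (u, v) \<in> ?D {}" for u v
    by (auto simp: flip_arc_def flipped_orientation_def insert_commute)
  have edge: "(case flip_arc S (u, v) of (u, v) \<Rightarrow> {u, v}) = {u, v}" for u v
    by (auto simp: flip_arc_def)
  have "lists_matching (?D S) M (map (flip_arc S) es)"
    unfolding lists_matching_def
  proof
    show "distinct (map (flip_arc S) es)"
      using es involution by (metis distinct_map inj_on_inverseI lists_matching_def)
    have "x \<in> set (map (flip_arc S) es) \<longleftrightarrow> x \<in> {(u, v) \<in> ?D S. {u, v} \<in> M}" for x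
    proof -
      obtain u v where x: "x = (u, v)" by fastforce
      have "x \<in> set (map (flip_arc S) es) \<longleftrightarrow> flip_arc S x \<in> set es"
        using involution by (metis (no_types, lifting) image_iff list.set_map)
      also have "\<dots> \<longleftrightarrow> flip_arc S (u, v) \<in> ?D {} \<and> {u, v} \<in> M"
        using es edge[of u v] by (auto simp: lists_matching_def x)
      finally show ?thesis by (auto simp: x mem)
    qed
    then show "set (map (flip_arc S) es) = {(u, v) \<in> ?D S. {u, v} \<in> M}" by blast
  qed
  then have "matching_sign num (?D S) M = order_sign num (ends (map (flip_arc S) es))"
    by (rule matching_sign_eq_order_sign[OF H ori num M])
  also have "\<dots> = (\<Prod>(u, v)\<leftarrow>es. if {u, v} \<in> S then -1 else 1) * matching_sign num (?D {}) M"
    by (simp add: order_sign_flip matching_sign_eq_order_sign[OF H ori num M es])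
  also have "(\<Prod>(u, v)\<leftarrow>es. if {u, v} \<in> S then -1 else 1 :: int) =
      (\<Prod>a\<in>set es. if (case a of (u, v) \<Rightarrow> {u, v}) \<in> S then -1 else 1)"
    using es by (subst prod.distinct_set_conv_list)
      (auto simp: lists_matching_def intro!: arg_cong[of _ _ prod_list])
  also have "\<dots> = flip_char M S"
    unfolding flip_char_def by (rule prod.reindex_bij_betw[OF bij])
  also have "\<dots> = flip_char S M"
    using finite_edges[OF H] sub S by (intro flip_char_commute) (auto elim: finite_subset)
  finally show ?thesis .
qed

text \<open>The coefficients \<open>x S\<close> are the Fourier coefficients of the sign vector \<open>s\<close> of the unreversed
  orientation. The resulting combination of the characters is \<open>s\<close>, and since the sign vector
  of the orientation reversed on \<open>S\<close> is the product of \<open>s\<close> with the character of \<open>S\<close>, the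
  combination of the sign vectors has the value \<open>s M * s M = 1\<close> at \<open>M\<close>.\<close>
lemma exists_k_pfaffian:
  assumes H: "simple_graph H"
  shows "\<exists>k. k_pfaffian H k"
proof -
  have fin: "finite (verts H)" using H by (simp add: simple_graph_def)
  obtain num where num: "enumeration H num"
  proof -
    have "\<exists>num. bij_betw num (verts H) {1..card (verts H)}"
      by (rule finite_same_card_bij) (use fin in auto)
    then show thesis using that by (auto simp only: enumeration_def)
  qed
  let ?D = "flipped_orientation H num" and ?E = "edges H"
  define s where "s M = real_of_int (matching_sign num (?D {}) M)" for M
  define PM where "PM = {M. perfect_matching H M}"
  have finE: "finite ?E" by (rule finite_edges[OF H])
  have PM: "M \<subseteq> ?E" if "M \<in> PM" for M
    using that by (simp add: PM_def perfect_matching_def)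
  have "PM \<subseteq> Pow ?E" by (rule subsetI) (rule PowI[OF PM])
  then have finPM: "finite PM" using finE by (rule finite_subset[OF _ finite_Pow_iff[THEN iffD2]])
  define x where "x S = (\<Sum>N\<in>PM. s N * flip_char S N) / 2 ^ card ?E" for S
  have "k_pfaffian H (card (Pow ?E))"
  proof (rule k_pfaffianI[OF num, of _ ?D x])
    fix M assume M: "perfect_matching H M"
    then have MPM: "M \<in> PM" by (simp add: PM_def)
    have "(\<Sum>S\<in>Pow ?E. of_int (matching_sign num (?D S) M) * x S) =
        (\<Sum>S\<in>Pow ?E. \<Sum>N\<in>PM. s M * s N / 2 ^ card ?E * (real_of_int (flip_char S M) * flip_char S N))"
    proof (rule sum.cong[OF refl])
      fix S assume "S \<in> Pow ?E"
      then have "S \<subseteq> ?E" by simp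
      then have "real_of_int (matching_sign num (?D S) M) = flip_char S M * s M"
        unfolding s_def by (subst matching_sign_flipped[OF H num M]) simp_all
      then have "of_int (matching_sign num (?D S) M) * x S =
         (\<Sum>N\<in>PM. flip_char S M * s M * (s N * flip_char S N / 2 ^ card ?E))"
        by (simp only: x_def sum_distrib_left sum_divide_distrib)
      also have "\<dots> = (\<Sum>N\<in>PM. s M * s N / 2 ^ card ?E * (real_of_int (flip_char S M) * flip_char S N))"
        by (rule sum.cong[OF refl]) simp
      finally show "of_int (matching_sign num (?D S) M) * x S =
         (\<Sum>N\<in>PM. s M * s N / 2 ^ card ?E * (real_of_int (flip_char S M) * flip_char S N))" .
    qed
    also have "\<dots> = (\<Sum>N\<in>PM. s M * s N / 2 ^ card ?E *
        (\<Sum>S\<in>Pow ?E. real_of_int (flip_char S M) * flip_char S N))"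
      unfolding sum_distrib_left by (rule sum.swap)
    also have "\<dots> = (\<Sum>N\<in>PM. if M = N then s M * s N else 0)"
    proof (rule sum.cong[OF refl])
      fix N assume N: "N \<in> PM"
      show "s M * s N / 2 ^ card ?E * (\<Sum>S\<in>Pow ?E. real_of_int (flip_char S M) * flip_char S N) =
          (if M = N then s M * s N else 0)"
        unfolding flip_char_orthogonal[OF finE PM[OF MPM] PM[OF N]] by simp
    qed
    also have "\<dots> = s M * s M" using finPM MPM by simp
    also have "\<dots> = real_of_int (matching_sign num (?D {}) M * matching_sign num (?D {}) M)"
      by (simp add: s_def)
    also have "\<dots> = 1"
      unfolding matching_sign_def sign_idempotent by simp
    finally show "(\<Sum>S\<in>Pow ?E. of_int (matching_sign num (?D S) M) * x S) = 1" .
  next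
    show "finite (Pow ?E)" using finE by simp
    show "orientation H (?D S)" for S by (rule orientation_flipped[OF H num])
  qed auto
  then show ?thesis by (rule exI)
qed

lemma k_pfaffian_pf:
  assumes "simple_graph H"
  shows "k_pfaffian H (pf H)"
proof -
  obtain k where k: "k_pfaffian H k" using exists_k_pfaffian[OF assms] by blast
  then have "k \<ge> 1" by (auto simp: k_pfaffian_def k_orientation_def)
  then show ?thesis
    unfolding pf_def using LeastI[of "\<lambda>k. k \<ge> 1 \<and> k_pfaffian H k" k] k by blast
qed

section \<open>Disjoint subgraphs that cover all vertices\<close>

lemma order_sign_cong:
  assumes "\<And>x y. x \<in> set xs \<Longrightarrow> y \<in> set xs \<Longrightarrow> order_sgn (num x) (num y) = order_sgn (num' x) (num' y)"
  shows "order_sign num xs = order_sign num' xs"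
  using assms
proof (induction xs)
  case (Cons x xs)
  have "map (\<lambda>y. order_sgn (num x) (num y)) xs = map (\<lambda>y. order_sgn (num' x) (num' y)) xs"
    using Cons.prems by auto
  moreover have "order_sign num xs = order_sign num' xs" using Cons by auto
  ultimately show ?case by (simp only: order_sign.simps)
qed simp

text \<open>Numbering the vertices of a subgraph by their rank in the numbering of the whole graph keeps
  their order, and with it all signs.\<close>
lemma exists_order_enumeration:
  assumes fin: "finite (verts H)" and inj: "inj_on num (verts H)"
  obtains num' where "enumeration H num'"
    "\<And>x y. x \<in> verts H \<Longrightarrow> y \<in> verts H \<Longrightarrow> order_sgn (num' x) (num' y) = order_sgn (num x) (num y)"
proof -
  define rank where "rank v = card {w \<in> verts H. num w \<le> num v}" for v
  have mono: "rank u < rank v" if "v \<in> verts H" "num u < num v" for u v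
  proof -
    have "v \<in> {w \<in> verts H. num w \<le> num v} - {w \<in> verts H. num w \<le> num u}"
      using that by simp
    then have "{w \<in> verts H. num w \<le> num u} \<subset> {w \<in> verts H. num w \<le> num v}"
      using that by fastforce
    then show ?thesis
      unfolding rank_def using fin by (intro psubset_card_mono) auto
  qed
  have neq: "num u \<noteq> num v" if "u \<in> verts H" "v \<in> verts H" "u \<noteq> v" for u v
    using that inj by (auto simp: inj_on_def)
  have inj': "inj_on rank (verts H)"
  proof (rule inj_onI, rule ccontr)
    fix u v assume *: "u \<in> verts H" "v \<in> verts H" "rank u = rank v" "u \<noteq> v"
    then show False
      using mono[of v u] mono[of u v] neq[of u v] by (cases "num u < num v") auto
  qed
  have "rank v \<in> {1..card (verts H)}" if "v \<in> verts H" for v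
    unfolding rank_def using that fin by (auto simp: Suc_le_eq card_gt_0_iff intro!: card_mono)
  then have "rank ` verts H = {1..card (verts H)}"
    using card_image[OF inj'] by (intro card_subset_eq) auto
  with inj' have "enumeration H rank" by (simp add: enumeration_def bij_betw_def)
  moreover have "order_sgn (rank x) (rank y) = order_sgn (num x) (num y)"
    if xy: "x \<in> verts H" "y \<in> verts H" for x y
  proof -
    consider "x = y" | "num x < num y" | "num y < num x"
      using neq[OF xy] by linarith
    then show ?thesis
      using mono[of y x] mono[of x y] xy by cases (auto simp: order_sgn_def)
  qed
  ultimately show ?thesis using that by blast
qed

text \<open>The arcs of an orientation that belong to edges of the subgraph \<open>H\<close>.\<close>
definition restrict_orientation :: "'a ugraph \<Rightarrow> ('a \<times> 'a) set \<Rightarrow> ('a \<times> 'a) set" where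
  "restrict_orientation H D = {(u, v) \<in> D. {u, v} \<in> edges H}"

lemma orientation_restrict:
  assumes "orientation G D" "edges H \<subseteq> edges G"
  shows "orientation H (restrict_orientation H D)"
  unfolding orientation_def bij_betw_def
proof
  have inj: "inj_on (\<lambda>(u, v). {u, v}) D" and img: "(\<lambda>(u, v). {u, v}) ` D = edges G"
    using assms(1) by (auto simp: orientation_def bij_betw_def)
  show "inj_on (\<lambda>(u, v). {u, v}) (restrict_orientation H D)"
    by (rule inj_on_subset[OF inj]) (auto simp: restrict_orientation_def)
  show "(\<lambda>(u, v). {u, v}) ` restrict_orientation H D = edges H"
  proof
    show "edges H \<subseteq> (\<lambda>(u, v). {u, v}) ` restrict_orientation H D"
    proof
      fix e assume e: "e \<in> edges H"
      then have "e \<in> (\<lambda>(u, v). {u, v}) ` D" using img assms(2) by auto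
      then show "e \<in> (\<lambda>(u, v). {u, v}) ` restrict_orientation H D"
        using e by (auto simp: restrict_orientation_def)
    qed
  qed (auto simp: restrict_orientation_def)
qed

text \<open>Two vertex-disjoint subgraphs that together contain all vertices of \<open>G\<close>. Edges of \<open>G\<close> that lie in
  neither of them are permitted.\<close>
locale spanning_union =
  fixes G H K :: "'a ugraph"
  assumes G: "simple_graph G" and H: "simple_graph H" and K: "simple_graph K"
    and verts: "verts G = verts H \<union> verts K" and disj: "verts H \<inter> verts K = {}"
    and edgesH: "edges H \<subseteq> edges G" and edgesK: "edges K \<subseteq> edges G"
begin

lemma edge_not_in_both: "e \<in> edges H \<Longrightarrow> e \<in> edges K \<Longrightarrow> False"
  using H K disj unfolding simple_graph_def
  by (metis card.empty le_infI subset_empty zero_neq_numeral)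

lemma perfect_matching_Un:
  assumes M: "perfect_matching H M" and N: "perfect_matching K N"
  shows "perfect_matching G (M \<union> N)"
proof -
  have subM: "M \<subseteq> edges H" and subN: "N \<subseteq> edges K"
    using M N by (auto simp: perfect_matching_def)
  have inH: "v \<in> verts H" if "e \<in> M" "v \<in> e" for e v
    using H subM that by (auto simp: simple_graph_def)
  have inK: "v \<in> verts K" if "e \<in> N" "v \<in> e" for e v
    using K subN that by (auto simp: simple_graph_def)
  have "\<exists>!e. e \<in> M \<union> N \<and> v \<in> e" if v: "v \<in> verts G" for v
  proof (cases "v \<in> verts H")
    case True
    then have "e \<in> M \<union> N \<and> v \<in> e \<longleftrightarrow> e \<in> M \<and> v \<in> e" for e
      using inK[of e v] disj by auto
    then show ?thesis using M True by (simp add: perfect_matching_def)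
  next
    case False
    then have "e \<in> M \<union> N \<and> v \<in> e \<longleftrightarrow> e \<in> N \<and> v \<in> e" for e
      using inH[of e v] by auto
    then show ?thesis using N False v verts by (simp add: perfect_matching_def)
  qed
  then show ?thesis
    using subM subN edgesH edgesK by (auto simp: perfect_matching_def)
qed

text \<open>Listing the arcs of \<open>M\<close> before those of \<open>N\<close>, the pairs of vertices within \<open>H\<close> and within \<open>K\<close> give the two
  signs, and the mixed pairs give a factor that depends only on the numbering.\<close>
lemma matching_sign_Un:
  assumes num: "enumeration G num" and numH: "enumeration H numH" and numK: "enumeration K numK"
    and ordH: "\<And>x y. x \<in> verts H \<Longrightarrow> y \<in> verts H \<Longrightarrow> order_sgn (numH x) (numH y) = order_sgn (num x) (num y)"
    and ordK: "\<And>x y. x \<in> verts K \<Longrightarrow> y \<in> verts K \<Longrightarrow> order_sgn (numK x) (numK y) = order_sgn (num x) (num y)"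
    and D: "orientation G D" and M: "perfect_matching H M" and N: "perfect_matching K N"
  shows "matching_sign num D (M \<union> N) =
    matching_sign numH (restrict_orientation H D) M * matching_sign numK (restrict_orientation K D) N *
    (\<Prod>x\<in>verts H. \<Prod>y\<in>verts K. order_sgn (num x) (num y))"
proof -
  note DH = orientation_restrict[OF D edgesH] and DK = orientation_restrict[OF D edgesK]
  obtain es where es: "lists_matching (restrict_orientation H D) M es"
    using exists_lists_matching[OF H DH] .
  obtain fs where fs: "lists_matching (restrict_orientation K D) N fs"
    using exists_lists_matching[OF K DK] .
  note endsH = ends_perfect_matching[OF H DH M es] and endsK = ends_perfect_matching[OF K DK N fs]
  have MN: "M \<subseteq> edges H" "N \<subseteq> edges K" using M N by (auto simp: perfect_matching_def)
  have "lists_matching D (M \<union> N) (es @ fs)"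
    using es fs MN edge_not_in_both
    by (auto simp: lists_matching_def restrict_orientation_def)
  then have "matching_sign num D (M \<union> N) = order_sign num (ends es @ ends fs)"
    using matching_sign_eq_order_sign[OF G D num perfect_matching_Un[OF M N]] by simp
  also have "\<dots> = order_sign num (ends es) * order_sign num (ends fs) *
      (\<Prod>x\<leftarrow>ends es. \<Prod>y\<leftarrow>ends fs. order_sgn (num x) (num y))"
    by (rule order_sign_append)
  also have "order_sign num (ends es) = order_sign numH (ends es)"
    using ordH endsH(2) by (intro order_sign_cong) auto
  also have "\<dots> = matching_sign numH (restrict_orientation H D) M"
    by (rule matching_sign_eq_order_sign[OF H DH numH M es, symmetric])
  also have "order_sign num (ends fs) = order_sign numK (ends fs)"
    using ordK endsK(2) by (intro order_sign_cong) auto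
  also have "\<dots> = matching_sign numK (restrict_orientation K D) N"
    by (rule matching_sign_eq_order_sign[OF K DK numK N fs, symmetric])
  also have "(\<Prod>x\<leftarrow>ends es. \<Prod>y\<leftarrow>ends fs. order_sgn (num x) (num y)) =
      (\<Prod>x\<in>verts H. \<Prod>y\<in>verts K. order_sgn (num x) (num y))"
    using endsH endsK by (simp flip: prod.distinct_set_conv_list)
  finally show ?thesis .
qed

lemma pf_add_le:
  assumes "matchable H" "matchable K"
  shows "pf H + pf K \<le> pf G + 1"
proof -
  obtain num Ds where num: "enumeration G num" and Ds: "k_orientation G (pf G) Ds"
    and pfaff: "pfaffian G num Ds"
    using k_pfaffian_pf[OF G] unfolding k_pfaffian_def by blast
  have len: "length Ds = pf G" and ori: "\<And>i. i < pf G \<Longrightarrow> orientation G (Ds ! i)"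
    using Ds by (auto simp: k_orientation_def)
  obtain x where x: "\<And>M. perfect_matching G M \<Longrightarrow>
      (\<Sum>i<pf G. of_int (matching_sign num (Ds ! i) M) * x i) = (1::real)"
    using pfaff by (auto simp: pfaffian_def signature_matrix_def len)
  have inj: "inj_on num (verts G)" using num by (simp add: enumeration_def bij_betw_def)
  have fin: "finite (verts H)" "finite (verts K)"
    using H K by (auto simp: simple_graph_def)
  obtain numH where numH: "enumeration H numH"
    and ordH: "\<And>x y. x \<in> verts H \<Longrightarrow> y \<in> verts H \<Longrightarrow> order_sgn (numH x) (numH y) = order_sgn (num x) (num y)"
    using exists_order_enumeration[OF fin(1), of num] inj verts by (auto simp: inj_on_Un)
  obtain numK where numK: "enumeration K numK"
    and ordK: "\<And>x y. x \<in> verts K \<Longrightarrow> y \<in> verts K \<Longrightarrow> order_sgn (numK x) (numK y) = order_sgn (num x) (num y)"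
    using exists_order_enumeration[OF fin(2), of num] inj verts by (auto simp: inj_on_Un)
  define \<gamma> where "\<gamma> = real_of_int (\<Prod>x\<in>verts H. \<Prod>y\<in>verts K. order_sgn (num x) (num y))"
  define a where "a M i = real_of_int (matching_sign numH (restrict_orientation H (Ds ! i)) M)" for M i
  define b where "b N i = real_of_int (matching_sign numK (restrict_orientation K (Ds ! i)) N)" for N i
  have sys: "(\<Sum>i<pf G. (\<gamma> * x i) * a M i * b N i) = 1"
    if M: "M \<in> {M. perfect_matching H M}" and N: "N \<in> {N. perfect_matching K N}" for M N
  proof -
    have "(\<Sum>i<pf G. (\<gamma> * x i) * a M i * b N i) =
        (\<Sum>i<pf G. of_int (matching_sign num (Ds ! i) (M \<union> N)) * x i)"
    proof (rule sum.cong[OF refl])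
      fix i assume "i \<in> {..<pf G}"
      then show "(\<gamma> * x i) * a M i * b N i = of_int (matching_sign num (Ds ! i) (M \<union> N)) * x i"
        using matching_sign_Un[OF num numH numK ordH ordK ori, of i M N] M N
        by (simp add: a_def b_def \<gamma>_def)
    qed
    then show ?thesis using x perfect_matching_Un M N by simp
  qed
  have ne: "{M. perfect_matching H M} \<noteq> {}" "{N. perfect_matching K N} \<noteq> {}"
    using assms by (auto simp: matchable_def)
  obtain I J y z where IJ: "I \<subseteq> {..<pf G}" "J \<subseteq> {..<pf G}" "I \<noteq> {}" "J \<noteq> {}"
    and card: "card I + card J = pf G + 1"
    and y: "\<And>M. M \<in> {M. perfect_matching H M} \<Longrightarrow> (\<Sum>i\<in>I. a M i * y i) = 1"
    and z: "\<And>N. N \<in> {N. perfect_matching K N} \<Longrightarrow> (\<Sum>j\<in>J. b N j * z j) = 1"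
    by (rule bilinear_system_split[OF ne sys]) blast+
  have finIJ: "finite I" "finite J" using IJ finite_subset by blast+
  have "k_pfaffian H (card I)"
  proof (rule k_pfaffianI[OF numH finIJ(1) IJ(3)])
    show "orientation H (restrict_orientation H (Ds ! i))" if "i \<in> I" for i
      using that IJ ori edgesH by (intro orientation_restrict) auto
  qed (use y in \<open>auto simp: a_def\<close>)
  moreover have "k_pfaffian K (card J)"
  proof (rule k_pfaffianI[OF numK finIJ(2) IJ(4)])
    show "orientation K (restrict_orientation K (Ds ! i))" if "i \<in> J" for i
      using that IJ ori edgesK by (intro orientation_restrict) auto
  qed (use z in \<open>auto simp: b_def\<close>)
  ultimately show ?thesis using pf_le card by (metis add_mono)
qed

end

theorem corollary20:
  fixes G H' H'' :: "'a ugraph"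
  assumes "simple_graph G"
    and "matching_covered G"
    and "conformal H' G"
    and "verts H' \<noteq> verts G"
    and "H'' = del_verts G (verts H')"
  shows "int (pf H') + int (pf H'') - 1 \<le> int (pf G)"
proof -
  have sub: "simple_graph H'" "verts H' \<subseteq> verts G" "edges H' \<subseteq> edges G"
    and matchable: "matchable H'" "matchable H''"
    using assms(3,5) by (auto simp: conformal_def subgraph_def)
  interpret spanning_union G H' H''
    using assms(1,5) sub by unfold_locales (auto simp: simple_graph_def del_verts_def)
  show ?thesis using pf_add_le[OF matchable] by linarith
qed

end
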